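(* For every $i\in\{0,\ldots,N\}$, the suffix domain $\mathcal X_i\subseteq\mathbb R^{n_i}$ is exactly the set of states $x_i\in\mathbb R^{n_i}$ at stage $i$ from which there exist controls $u_i,\ldots,u_{N-1}$ and states $x_{i+1},\ldots,x_N$ satisfying every constraint from stage $i$ through the terminal stage, that is, $$x_{j+1}=A_jx_j+B_ju_j+c_j,\qquad C_jx_j+D_ju_j+d_j=0,\qquad E_jx_j+e_j=0\qquad (j=i,\ldots,N-1),$$ and $E_Nx_N+e_N=0$.
   Context: Setting: a horizon $N\ge 1$; state dimensions $n_0,\ldots,n_N$ and control dimensions $m_0,\ldots,m_{N-1}$ that may vary by stage; real matrices and vectors of compatible sizes $A_i\in\mathbb R^{n_{i+1}\times n_i}$, $B_i\in\mathbb R^{n_{i+1}\times m_i}$, $c_i\in\mathbb R^{n_{i+1}}$, $C_i,D_i,d_i$ (for $i=0,\ldots,N-1$), and $E_i,e_i$ (for $i=0,\ldots,N$). Empty matrices represent absent constraints; no rank assumptions are made. The stage constraints are the dynamics $x_{i+1}=A_ix_i+B_iu_i+c_i$, the mixed constraint $C_ix_i+D_iu_i+d_i=0$, and the state constraint $E_ix_i+e_i=0$ for $i=0,\ldots,N-1$, together with the terminal constraint $E_Nx_N+e_N=0$. (The prescribed initial condition is not part of these stage constraints.) An affine relation over endpoints $a\in\mathbb R^{n_a}$, $b\in\mathbb R^{n_b}$ is a set $\{(a,b):La+Rb+\ell=0\}$. Composition of adjacent relations is $\mathcal R_{ab}\circ\mathcal R_{bc}=\{(a,c):\exists b,\ (a,b)\in\mathcal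 R_{ab},\ (b,c)\in\mathcal R_{bc}\}$; it is associative. For $i=0,\ldots,N-1$ the base relation is $$\mathcal R_i=\{(x_i,x_{i+1})\in\mathbb R^{n_i}\times\mathbb R^{n_{i+1}}:\exists u_i\in\mathbb R^{m_i},\ x_{i+1}=A_ix_i+B_iu_i+c_i,\ C_ix_i+D_iu_i+d_i=0,\ E_ix_i+e_i=0\}.$$ The terminal relation is the unary relation $\mathcal R_N=\{x_N:E_Nx_N+e_N=0\}$, regarded as a relation from $x_N$ to a zero-dimensional dummy endpoint. The suffix relation is $\mathcal S_i=\mathcal R_i\circ\mathcal R_{i+1}\circ\cdots\circ\mathcal R_N$ (with $\mathcal S_N=\mathcal R_N$). Since its right endpoint is the zero-dimensional dummy endpoint, $\mathcal S_i$ is identified with a subset $\mathcal X_i\subseteq\mathbb R^{n_i}$, which has a representation $\mathcal X_i=\{x_i:H_ix_i+h_i=0\}$. *)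

theory Defs
  imports "Jordan_Normal_Form.Matrix"
begin

text \<open>
  Endpoints of all dimensions live in the single type \<^typ>\<open>real vec\<close>; sizes are tracked by
  \<^const>\<open>carrier_vec\<close> and \<^const>\<open>carrier_mat\<close>. The numbers \<open>p i\<close> and \<open>q i\<close> count the rows of
  the mixed and of the state constraints at stage \<open>i\<close>. They may be \<open>0\<close>, in which case the
  corresponding equation holds between vectors of dimension \<open>0\<close> and is no constraint.
\<close>

locale stage_constraints =
  fixes N :: nat
    and n m p q :: "nat \<Rightarrow> nat"
    and A B :: "nat \<Rightarrow> real mat" and c :: "nat \<Rightarrow> real vec"
    and C D :: "nat \<Rightarrow> real mat" and d :: "nat \<Rightarrow> real vec"
    and E :: "nat \<Rightarrow> real mat" and e :: "nat \<Rightarrow> real vec"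
  assumes horizon: "N \<ge> 1"
    and A_carrier: "\<And>i. i < N \<Longrightarrow> A i \<in> carrier_mat (n (Suc i)) (n i)"
    and B_carrier: "\<And>i. i < N \<Longrightarrow> B i \<in> carrier_mat (n (Suc i)) (m i)"
    and c_carrier: "\<And>i. i < N \<Longrightarrow> c i \<in> carrier_vec (n (Suc i))"
    and C_carrier: "\<And>i. i < N \<Longrightarrow> C i \<in> carrier_mat (p i) (n i)"
    and D_carrier: "\<And>i. i < N \<Longrightarrow> D i \<in> carrier_mat (p i) (m i)"
    and d_carrier: "\<And>i. i < N \<Longrightarrow> d i \<in> carrier_vec (p i)"
    and E_carrier: "\<And>i. i \<le> N \<Longrightarrow> E i \<in> carrier_mat (q i) (n i)"
    and e_carrier: "\<And>i. i \<le> N \<Longrightarrow> e i \<in> carrier_vec (q i)"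
begin

definition base_rel :: "nat \<Rightarrow> (real vec \<times> real vec) set" where
  "base_rel i =
    {(x, y). x \<in> carrier_vec (n i) \<and> y \<in> carrier_vec (n (Suc i)) \<and>
      (\<exists>u \<in> carrier_vec (m i).
        y = A i *\<^sub>v x + B i *\<^sub>v u + c i \<and>
        C i *\<^sub>v x + D i *\<^sub>v u + d i = 0\<^sub>v (p i) \<and>
        E i *\<^sub>v x + e i = 0\<^sub>v (q i))}"

text \<open>The second component is the zero-dimensional dummy endpoint.\<close>

definition terminal_rel :: "(real vec \<times> real vec) set" where
  "terminal_rel =
    {(x, z). x \<in> carrier_vec (n N) \<and> z \<in> carrier_vec 0 \<and> E N *\<^sub>v x + e N = 0\<^sub>v (q N)}"

text \<open>
  Composition of adjacent relations is \<^const>\<open>relcomp\<close>, written \<open>O\<close>. The chain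
  \<open>base_rel i O \<dots> O base_rel (N - 1) O terminal_rel\<close> is bracketed to the right;
  for \<open>i = N\<close> it is \<open>terminal_rel\<close> alone.
\<close>

definition suffix_rel :: "nat \<Rightarrow> (real vec \<times> real vec) set" where
  "suffix_rel i = foldr (O) (map base_rel [i..<N]) terminal_rel"

text \<open>\<^term>\<open>0\<^sub>v 0\<close> is the only element of \<^term>\<open>carrier_vec 0\<close>.\<close>

definition suffix_domain :: "nat \<Rightarrow> real vec set" where
  "suffix_domain i = {x. (x, 0\<^sub>v 0) \<in> suffix_rel i}"

end

end

theory Submission imports Defs begin

text \<open>Composition of relations hides an existential over the shared endpoint, so membership in
  a chain of compositions means that all intermediate endpoints exist at once, that is, a trajectory
  exists whose consecutive pairs lie in the links; this is \<open>foldr_relcomp_upt\<close>. Each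
  link \<open>base_rel j\<close> hides one more existential, over the control at stage j. Once the
  trajectory is fixed, these choices are independent across stages, so they assemble into one
  control sequence. The remaining work is bookkeeping of dimensions.\<close>

text \<open>Downward induction from \<open>N\<close>, attaching one link at the front. The
  trajectory is a total function on the naturals; its values outside i..N are unconstrained.\<close>

lemma foldr_relcomp_upt:
  fixes R :: "nat \<Rightarrow> ('a \<times> 'a) set" and T :: "('a \<times> 'b) set"
  assumes "i \<le> N"
  shows "(a, z) \<in> foldr (O) (map R [i..<N]) T \<longleftrightarrow>
    (\<exists>x. x i = a \<and> (\<forall>j\<in>{i..<N}. (x j, x (Suc j)) \<in> R j) \<and> (x N, z) \<in> T)"
  using assms
proof (induction i arbitrary: a rule: inc_induct)
  case base
  then show ?case by auto
next
  case (step i)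
  have "(a, z) \<in> foldr (O) (map R [i..<N]) T \<longleftrightarrow>
      (\<exists>b. (a, b) \<in> R i \<and> (b, z) \<in> foldr (O) (map R [Suc i..<N]) T)"
    using step.hyps by (auto simp: upt_conv_Cons)
  \<comment> \<open>The shared endpoint \<open>b\<close> is the value at \<open>Suc i\<close> of the
    tail trajectory given by the induction hypothesis, so it can be eliminated.\<close>
  also have "\<dots> \<longleftrightarrow> (\<exists>x. (a, x (Suc i)) \<in> R i \<and>
      (\<forall>j\<in>{Suc i..<N}. (x j, x (Suc j)) \<in> R j) \<and> (x N, z) \<in> T)"
    unfolding step.IH by auto
  also have "\<dots> \<longleftrightarrow> (\<exists>x. x i = a \<and> (\<forall>j\<in>{i..<N}. (x j, x (Suc j)) \<in> R j) \<and> (x N, z) \<in> T)"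
    (is "?L \<longleftrightarrow> ?R")
  proof
    assume ?L
    then obtain x where x: "(a, x (Suc i)) \<in> R i"
      "\<forall>j\<in>{Suc i..<N}. (x j, x (Suc j)) \<in> R j" "(x N, z) \<in> T" by blast
    \<comment> \<open>The tail conditions involve only indices above \<open>i\<close> (also
      \<open>N\<close>, since i < N), so resetting the value at \<open>i\<close> to \<open>a\<close>
      preserves them.\<close>
    have "(x(i := a)) i = a \<and> (\<forall>j\<in>{i..<N}. ((x(i := a)) j, (x(i := a)) (Suc j)) \<in> R j) \<and>
        ((x(i := a)) N, z) \<in> T"
      using x step.hyps by auto
    then show ?R by blast
  next
    assume ?R
    then show ?L using step.hyps by fastforce
  qed
  finally show ?case .
qed

theorem theorem3:
  fixes N :: nat
    and n m p q :: "nat \<Rightarrow> nat"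
    and A B :: "nat \<Rightarrow> real mat" and c :: "nat \<Rightarrow> real vec"
    and C D :: "nat \<Rightarrow> real mat" and d :: "nat \<Rightarrow> real vec"
    and E :: "nat \<Rightarrow> real mat" and e :: "nat \<Rightarrow> real vec"
    and i :: nat
  assumes "stage_constraints N n m p q A B c C D d E e"
    and "i \<le> N"
  shows "stage_constraints.suffix_domain N n m p q A B c C D d E e i =
    {x\<^sub>i \<in> carrier_vec (n i). \<exists>(u :: nat \<Rightarrow> real vec) (x :: nat \<Rightarrow> real vec).
      x i = x\<^sub>i \<and>
      (\<forall>j\<in>{i..<N}. u j \<in> carrier_vec (m j)) \<and>
      (\<forall>j\<in>{i<..N}. x j \<in> carrier_vec (n j)) \<and>
      (\<forall>j\<in>{i..<N}.
        x (Suc j) = A j *\<^sub>v x j + B j *\<^sub>v u j + c j \<and>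
        C j *\<^sub>v x j + D j *\<^sub>v u j + d j = 0\<^sub>v (p j) \<and>
        E j *\<^sub>v x j + e j = 0\<^sub>v (q j)) \<and>
      E N *\<^sub>v x N + e N = 0\<^sub>v (q N)}"
proof -
  interpret stage_constraints N n m p q A B c C D d E e by fact
  let ?F = "\<lambda>x u j. x (Suc j) = A j *\<^sub>v x j + B j *\<^sub>v u + c j \<and>
        C j *\<^sub>v x j + D j *\<^sub>v u + d j = 0\<^sub>v (p j) \<and>
        E j *\<^sub>v x j + e j = 0\<^sub>v (q j)"
  let ?K = "\<lambda>x. \<forall>j\<in>{i..N}. x j \<in> carrier_vec (n j)"
  have carr: "?K x \<longleftrightarrow> x i \<in> carrier_vec (n i) \<and> (\<forall>j\<in>{i<..N}. x j \<in> carrier_vec (n j))" for x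
    using \<open>i \<le> N\<close> by (metis atLeastAtMost_iff greaterThanAtMost_iff le_neq_implies_less
        less_imp_le order_refl)
  have "(\<forall>j\<in>{i..<N}. (x j, x (Suc j)) \<in> base_rel j) \<and> (x N, 0\<^sub>v 0) \<in> terminal_rel \<longleftrightarrow>
      ?K x \<and> (\<exists>u. \<forall>j\<in>{i..<N}. u j \<in> carrier_vec (m j) \<and> ?F x (u j) j) \<and>
      E N *\<^sub>v x N + e N = 0\<^sub>v (q N)" for x
  proof -
    \<comment> \<open>The links give the dimensions of both their endpoints; the conjunct for
      \<open>N\<close> comes from the terminal relation and is all there is when i = N.\<close>
    have "?K x \<longleftrightarrow> (\<forall>j\<in>{i..<N}. x j \<in> carrier_vec (n j) \<and> x (Suc j) \<in> carrier_vec (n (Suc j))) \<and>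
        x N \<in> carrier_vec (n N)"
    proof
      assume "?K x"
      then show "(\<forall>j\<in>{i..<N}. x j \<in> carrier_vec (n j) \<and> x (Suc j) \<in> carrier_vec (n (Suc j))) \<and>
          x N \<in> carrier_vec (n N)"
        using \<open>i \<le> N\<close> by simp
    qed (auto simp: atLeastLessThanSuc simp flip: atLeastLessThanSuc_atLeastAtMost)
    \<comment> \<open>Bounded choice turns one control per stage into a control sequence.\<close>
    moreover have "(\<exists>u. \<forall>j\<in>{i..<N}. u j \<in> carrier_vec (m j) \<and> ?F x (u j) j) \<longleftrightarrow>
        (\<forall>j\<in>{i..<N}. \<exists>u\<in>carrier_vec (m j). ?F x u j)"
      unfolding Bex_def by (rule bchoice_iff[symmetric])
    ultimately show ?thesis
      unfolding base_rel_def terminal_rel_def by auto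
  qed
  then have "x\<^sub>i \<in> suffix_domain i \<longleftrightarrow> (\<exists>x. x i = x\<^sub>i \<and> ?K x \<and>
      (\<exists>u. \<forall>j\<in>{i..<N}. u j \<in> carrier_vec (m j) \<and> ?F x (u j) j) \<and>
      E N *\<^sub>v x N + e N = 0\<^sub>v (q N))" for x\<^sub>i
    unfolding suffix_domain_def suffix_rel_def mem_Collect_eq foldr_relcomp_upt[OF \<open>i \<le> N\<close>]
    by simp
  \<comment> \<open>Separates the dimension condition at stage \<open>i\<close> from the later ones,
    as in the set to be matched.\<close>
  note mem = this[unfolded carr ball_conj_distrib]
  show ?thesis
    by (rule Set.set_eqI, unfold mem mem_Collect_eq ball_conj_distrib) blast
qed

end
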